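(* Let $p\in\mathbb{N}$, $A\in\mathbb{R}^{p\times p}$ and $b\in\mathbb{R}^p$. The affine transformation $\mathbb{R}^p\to\mathbb{R}^p$, $h\mapsto Ah+b$, of the lifted space can be represented by a single compositional tensor train (CTT) layer with rank at most $p$.
   Context: A single CTT layer on the lifted space $\mathbb{R}^p$ with rank at most $p$ is a map of the form $h\mapsto h+\psi(h)$, where $\psi:\mathbb{R}^p\to\mathbb{R}^p$ is in tensor-train format with ranks at most $p$: there are matrix-valued functions $U_i:\mathbb{R}\to\mathbb{R}^{r_{i-1}\times r_i}$, $1\le i\le p$, with $r_0=p$, $r_p=1$, $r_i\le p$ for $1\le i\le p-1$, and entries in the span of the univariate basis $\Phi$, such that $\psi(h)=U_1(h_1)\cdots U_p(h_p)$. The univariate basis $\Phi$ (a finite set of functions $\mathbb{R}\to\mathbb{R}$) is assumed to satisfy $1,\mathrm{Id}\in\operatorname{span}\Phi$. *)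

theory Defs
  imports Jordan_Normal_Form.Matrix "HOL-Library.Function_Algebras"
begin

global_interpretation real_fun: vector_space "\<lambda>(c::real) (f::real \<Rightarrow> real) x. c * f x"
  by unfold_locales (auto simp: fun_eq_iff algebra_simps)

text \<open>
  The cores are indexed from 1, as in \<open>U\<^sub>1(h\<^sub>1) \<cdots> U\<^sub>p(h\<^sub>p)\<close>, whereas vector coordinates
  are indexed from 0; hence core number \<open>Suc i\<close> is evaluated at \<open>h $ i\<close>.
  The identity of size \<open>m\<close> starts the product, \<open>m\<close> being the row dimension of the first core.
\<close>

primrec core_prod ::
  "nat \<Rightarrow> (nat \<Rightarrow> real \<Rightarrow> real mat) \<Rightarrow> real vec \<Rightarrow> nat \<Rightarrow> real mat" where
  "core_prod m U h 0 = 1\<^sub>m m"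
| "core_prod m U h (Suc i) = core_prod m U h i * U (Suc i) (h $ i)"

text \<open>
  Maps on \<open>\<real>\<^sup>p\<close> are HOL functions of which only the values on \<^term>\<open>carrier_vec p\<close> matter.
  Since \<open>r\<^sub>p = 1\<close>, the product of the cores has a single column, which is the value of \<open>\<psi>\<close>.
  Ranks are positive, so that no empty matrices occur. No dimension \<open>p = 0\<close> is possible,
  because \<open>r\<^sub>0 = p\<close> and \<open>r\<^sub>p = 1\<close>.
\<close>

definition tensor_train ::
  "(real \<Rightarrow> real) set \<Rightarrow> nat \<Rightarrow> nat \<Rightarrow> (real vec \<Rightarrow> real vec) \<Rightarrow> bool" where
  "tensor_train \<Phi> p R \<psi> \<longleftrightarrow>
     (\<exists>(r :: nat \<Rightarrow> nat) (U :: nat \<Rightarrow> real \<Rightarrow> real mat).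
        r 0 = p \<and> r p = 1 \<and> (\<forall>i\<in>{1..<p}. 1 \<le> r i \<and> r i \<le> R) \<and>
        (\<forall>i\<in>{1..p}. \<forall>x. U i x \<in> carrier_mat (r (i - 1)) (r i)) \<and>
        (\<forall>i\<in>{1..p}. \<forall>k<r (i - 1). \<forall>l<r i. (\<lambda>x. U i x $$ (k, l)) \<in> real_fun.span \<Phi>) \<and>
        (\<forall>h\<in>carrier_vec p. \<psi> h = col (core_prod p U h p) 0))"

definition ctt_layer ::
  "(real \<Rightarrow> real) set \<Rightarrow> nat \<Rightarrow> nat \<Rightarrow> (real vec \<Rightarrow> real vec) \<Rightarrow> bool" where
  "ctt_layer \<Phi> p R f \<longleftrightarrow>
     (\<exists>\<psi>. tensor_train \<Phi> p R \<psi> \<and> (\<forall>h\<in>carrier_vec p. f h = h + \<psi> h))"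

end

theory Submission
  imports Defs
begin

text \<open>
  Write \<open>g(h) = M h + b\<close> and split its coordinates after the \<open>i\<close>-th one: as a function of the
  remaining coordinates, \<open>g\<close> lies in the span of \<open>1\<close> and the last \<open>p - i\<close> coordinate
  functions, so rank \<open>p - i + 1\<close> suffices at position \<open>i \<ge> 1\<close>. Accordingly the partial product
  of the first \<open>i\<close> cores has as columns the affine part accumulated so far and the columns of
  \<open>M\<close> that are not yet used; each further core multiplies the next unused column by its variable,
  adds it to the first column and shifts the others. The layer is obtained with \<open>M = A - 1\<close>.
\<close>

lemma affine_in_span:
  assumes "(\<lambda>x. 1) \<in> real_fun.span \<Phi>" and "id \<in> real_fun.span \<Phi>"
  shows "(\<lambda>x. a * x + c) \<in> real_fun.span \<Phi>"
proof -
  have "(\<lambda>x. a * id x) + (\<lambda>x. c * 1) \<in> real_fun.span \<Phi>"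
    by (intro real_fun.span_add real_fun.span_scale assms)
  then show ?thesis
    by (simp add: plus_fun_def)
qed

text \<open>The value at 0 is fixed by the row dimension of the first core; \<open>p + 1 - i\<close>
  would be one too large there. For \<open>p \<ge> 1\<close> it gives \<open>p\<close> at 1 and the
  required 1 at \<open>p\<close>.\<close>

definition affine_rank :: "nat \<Rightarrow> nat \<Rightarrow> nat" where
  "affine_rank p i = (if i = 0 then p else p + 1 - i)"

definition affine_core :: "real mat \<Rightarrow> real vec \<Rightarrow> nat \<Rightarrow> nat \<Rightarrow> real \<Rightarrow> real mat" where
  "affine_core M b p i x = mat (affine_rank p (i - 1)) (affine_rank p i) (\<lambda>(k, l).
     if i = 1 then (if l = 0 then M $$ (k, 0) * x + b $ k else M $$ (k, l))
     else if l = 0 then (if k = 0 then 1 else if k = 1 then x else 0)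
     else if k = l + 1 then 1 else 0)"

text \<open>Each entry is a polynomial in \<open>x\<close> of degree at most 1, and it is constant
  outside column 0.\<close>

lemma affine_core_entry_in_span:
  assumes "(\<lambda>x. 1) \<in> real_fun.span \<Phi>" and "id \<in> real_fun.span \<Phi>"
    and "k < affine_rank p (i - 1)" and "l < affine_rank p i"
  shows "(\<lambda>x. affine_core M b p i x $$ (k, l)) \<in> real_fun.span \<Phi>"
proof -
  have "\<exists>a c. (\<lambda>x. affine_core M b p i x $$ (k, l)) = (\<lambda>x. a * x + c)"
  proof (cases "l = 0")
    case True
    then show ?thesis
      using assms(3,4)
      by (intro exI[of _ "if i = 1 then M $$ (k, 0) else if k = 1 then 1 else 0"]
            exI[of _ "if i = 1 then b $ k else if k = 0 then 1 else 0"])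
        (auto simp: affine_core_def fun_eq_iff)
  next
    case False
    then show ?thesis
      using assms(3,4)
      by (intro exI[of _ 0] exI[of _ "if i = 1 then M $$ (k, l) else if k = l + 1 then 1 else 0"])
        (auto simp: affine_core_def fun_eq_iff)
  qed
  then show ?thesis
    using affine_in_span[OF assms(1,2)] by auto
qed

text \<open>Invariant along the product: for \<open>i < p\<close>, column 1 is the column of
  \<open>M\<close> with index \<open>i\<close>, which the next core consumes. The induction starts
  at 1, since the identity at 0 carries no data of \<open>M\<close> and \<open>b\<close>.\<close>

lemma core_prod_affine_core:
  assumes "1 \<le> i" and "i \<le> p" and M: "M \<in> carrier_mat p p"
  shows "core_prod p (affine_core M b p) h i = mat p (p + 1 - i) (\<lambda>(k, l).
    if l = 0 then (\<Sum>j<i. M $$ (k, j) * h $ j) + b $ k else M $$ (k, i - 1 + l))"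
  using assms(1,2)
proof (induction i rule: dec_induct)
  case base
  have "affine_core M b p 1 (h $ 0) \<in> carrier_mat p p"
    by (simp add: affine_core_def affine_rank_def)
  then show ?case
    by (auto simp: affine_core_def affine_rank_def intro!: eq_matI)
next
  case (step i)
  let ?P = "\<lambda>k l. if l = 0 then (\<Sum>j<i. M $$ (k, j) * h $ j) + b $ k else M $$ (k, i - 1 + l)"
  have IH: "core_prod p (affine_core M b p) h i = mat p (p + 1 - i) (\<lambda>(k, l). ?P k l)"
    using step by simp
  \<comment> \<open>Column 0 is written as a sum of two indicators, so that its product with a row
    splits into two sums with a single possibly nonzero term each.\<close>
  have U: "affine_core M b p (Suc i) (h $ i) = mat (p + 1 - i) (p - i) (\<lambda>(k, l).
      if l = 0 then (if k = 0 then 1 else 0) + (if k = 1 then h $ i else 0)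
      else if k = l + 1 then 1 else 0)"
    using step by (auto simp: affine_core_def affine_rank_def intro!: eq_matI)
  show ?case
  proof (rule eq_matI, goal_cases)
    case (1 k l)
    then have kl: "k < p" "l < p - i" by auto
    have "core_prod p (affine_core M b p) h (Suc i) $$ (k, l) =
        (\<Sum>m<p + 1 - i. ?P k m *
          (if l = 0 then (if m = 0 then 1 else 0) + (if m = 1 then h $ i else 0)
           else if m = l + 1 then 1 else 0))"
      using kl by (simp add: IH U scalar_prod_def atLeast0LessThan)
    \<comment> \<open>Index 1 is in range because \<open>l < p - i\<close> forces
      \<open>i < p\<close>; since \<open>1 \<le> i\<close>, \<open>?P k 1\<close> is
      \<open>M $$ (k, i)\<close>, the next summand.\<close>
    also have "\<dots> = (if l = 0 then ?P k 0 + ?P k 1 * h $ i else ?P k (l + 1))"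
    proof (cases "l = 0")
      case True
      then have "(\<Sum>m<p + 1 - i. ?P k m *
          (if l = 0 then (if m = 0 then 1 else 0) + (if m = 1 then h $ i else 0)
           else if m = l + 1 then 1 else 0)) =
        (\<Sum>m<p + 1 - i. if m = 0 then ?P k m else 0) +
        (\<Sum>m<p + 1 - i. if m = 1 then ?P k m * h $ i else 0)"
        unfolding sum.distrib[symmetric] by (intro sum.cong) auto
      then show ?thesis
        using True kl by (simp only: sum.delta finite_lessThan) auto
    next
      case False
      then have "(\<Sum>m<p + 1 - i. ?P k m *
          (if l = 0 then (if m = 0 then 1 else 0) + (if m = 1 then h $ i else 0)
           else if m = l + 1 then 1 else 0)) =
        (\<Sum>m<p + 1 - i. if m = l + 1 then ?P k m else 0)"
        by (intro sum.cong) auto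
      then show ?thesis
        using False kl by (simp only: sum.delta finite_lessThan) auto
    qed
    finally show ?case
      using kl \<open>1 \<le> i\<close> by simp
  qed (simp_all add: IH U)
qed

theorem tensor_train_affine:
  assumes "p \<ge> 1"
    and "(\<lambda>x. 1) \<in> real_fun.span \<Phi>" and "id \<in> real_fun.span \<Phi>"
    and M: "M \<in> carrier_mat p p" and b: "b \<in> carrier_vec p"
  shows "tensor_train \<Phi> p p (\<lambda>h. M *\<^sub>v h + b)"
  unfolding tensor_train_def
proof (intro exI[of _ "affine_rank p"] exI[of _ "affine_core M b p"] conjI ballI allI impI)
  fix h :: "real vec"
  assume "h \<in> carrier_vec p"
  \<comment> \<open>At \<open>i = p\<close> only column 0 is left, and its sum runs over all columns
    of \<open>M\<close>.\<close>
  then show "M *\<^sub>v h + b = col (core_prod p (affine_core M b p) h p) 0"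
    using M b core_prod_affine_core[OF \<open>p \<ge> 1\<close> order_refl M, of b h]
    by (intro eq_vecI) (auto simp: scalar_prod_def atLeast0LessThan)
qed (use assms affine_core_entry_in_span in \<open>auto simp: affine_rank_def affine_core_def\<close>)

theorem corollary3p3:
  fixes p :: nat and \<Phi> :: "(real \<Rightarrow> real) set" and A :: "real mat" and b :: "real vec"
  assumes "p \<ge> 1"
    and "finite \<Phi>"
    and "(\<lambda>x. 1) \<in> real_fun.span \<Phi>"
    and "id \<in> real_fun.span \<Phi>"
    and "A \<in> carrier_mat p p"
    and "b \<in> carrier_vec p"
  shows "ctt_layer \<Phi> p p (\<lambda>h. A *\<^sub>v h + b)"
proof -
  have "tensor_train \<Phi> p p (\<lambda>h. (A - 1\<^sub>m p) *\<^sub>v h + b)"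
    using assms by (intro tensor_train_affine) auto
  moreover have "A *\<^sub>v h + b = h + ((A - 1\<^sub>m p) *\<^sub>v h + b)" if "h \<in> carrier_vec p" for h
    using assms that by (intro eq_vecI) (auto simp: minus_mult_distrib_mat_vec)
  ultimately show ?thesis
    unfolding ctt_layer_def by blast
qed

end
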